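(* Let $X$ be a real Banach space and let $C$ be a nonempty weakly compact subset of $X$. Then the set of all $x \in X$ such that the function $z \mapsto \|x-z\| - \|z\|$ attains its supremum on $C$ is (norm) dense in $X$.
   Context: A function $g : C \to \mathbb{R}$ attains its supremum on $C$ if there is $z_0 \in C$ with $g(z_0) = \sup_{z \in C} g(z)$. *)

theory Defs
  imports "HOL-Analysis.Analysis"
begin

text \<open>The weak topology is the coarsest topology on the underlying space for which every
  norm-continuous linear functional is continuous.\<close>

definition weak_topology :: "'a::real_normed_vector topology" where
  "weak_topology =
     topology_generated_by {f -` U | (f :: 'a \<Rightarrow> real) U. bounded_linear f \<and> open U}"

lemma topspace_weak_topology [simp]: "topspace weak_topology = UNIV"
proof -
  have "UNIV \<in> {f -` U | (f :: 'a \<Rightarrow> real) U. bounded_linear f \<and> open U}"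
    by (rule CollectI, rule exI[of _ "\<lambda>_. 0"], rule exI[of _ UNIV]) simp
  then show ?thesis
    unfolding weak_topology_def topology_generated_by_topspace by blast
qed

text \<open>The supremum is taken in the extended reals, so that it is \<open>\<infinity>\<close>, and hence not attained,
  when \<open>g\<close> is unbounded above on \<open>C\<close>.\<close>

definition attains_sup_on :: "('a \<Rightarrow> real) \<Rightarrow> 'a set \<Rightarrow> bool" where
  "attains_sup_on g C \<longleftrightarrow> (\<exists>z0\<in>C. ereal (g z0) = (SUP z\<in>C. ereal (g z)))"

end

theory Submission
  imports Defs
begin

text \<open>Let \<open>f x\<close> be the supremum of \<open>norm (x - z) - norm z\<close> over \<open>z \<in> C\<close>, a convex 1-Lipschitz
  function of \<open>x\<close>. As in Lau's theorem on farthest points, moving \<open>x\<close> slightly away from an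
  almost maximal \<open>z\<close> and Baire's theorem show that, for a dense set of \<open>x\<close>, every subgradient
  \<open>l\<close> of \<open>f\<close> at \<open>x\<close> satisfies \<open>sup {l (x - z) - norm z | z \<in> C} = f x\<close>. The function
  \<open>z \<mapsto> l (x - z) - norm z\<close> is weakly upper semicontinuous, so it attains this supremum at some
  \<open>z0 \<in> C\<close>; since \<open>l\<close> has norm at most 1, \<open>norm (x - z0) - norm z0 \<ge> f x\<close>.\<close>

section \<open>Sublinear functions and subgradients\<close>

text \<open>Homogeneity is only an inequality for positive factors, a form that passes easily to
  infima; applying it to the inverse factor gives back equality.\<close>

definition sublinear :: "('a::real_vector \<Rightarrow> real) \<Rightarrow> bool" where
  "sublinear p \<longleftrightarrow>
     (\<forall>x y. p (x + y) \<le> p x + p y) \<and> (\<forall>c x. 0 < c \<longrightarrow> p (c *\<^sub>R x) \<le> c * p x)"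

lemma sublinearI:
  assumes "\<And>x y. p (x + y) \<le> p x + p y" and "\<And>c x. 0 < c \<Longrightarrow> p (c *\<^sub>R x) \<le> c * p x"
  shows "sublinear p"
  using assms by (simp add: sublinear_def)

lemma sublinear_add: "sublinear p \<Longrightarrow> p (x + y) \<le> p x + p y"
  by (simp add: sublinear_def)

lemma sublinear_scaleR:
  assumes "sublinear p" and "0 < c"
  shows "p (c *\<^sub>R x) = c * p x"
proof (rule antisym)
  show "p (c *\<^sub>R x) \<le> c * p x"
    using assms by (simp add: sublinear_def)
  have "p (inverse c *\<^sub>R c *\<^sub>R x) \<le> inverse c * p (c *\<^sub>R x)"
    using assms unfolding sublinear_def by (meson positive_imp_inverse_positive)
  then show "c * p x \<le> p (c *\<^sub>R x)"
    using assms(2) by (simp add: field_simps)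
qed

lemma sublinear_zero: "sublinear p \<Longrightarrow> p 0 = 0"
  using sublinear_scaleR[of p 2 0] by simp

lemma sublinear_minus: "sublinear p \<Longrightarrow> - p (- x) \<le> p x"
  using sublinear_add[of p x "- x"] sublinear_zero[of p] by simp

text \<open>Supplies the lower bounds for Zorn's lemma. The infimum is finite because
  \<open>q x\<close> is at least \<open>- q (- x)\<close>, hence at least
  \<open>- p (- x)\<close>.\<close>

lemma sublinear_Inf_chain:
  assumes ne: "K \<noteq> {}" and sub: "\<And>q. q \<in> K \<Longrightarrow> sublinear q \<and> q \<le> p"
    and chain: "\<And>q r. q \<in> K \<Longrightarrow> r \<in> K \<Longrightarrow> q \<le> r \<or> r \<le> q"
  defines "m \<equiv> \<lambda>x. INF q\<in>K. q x"
  shows "sublinear m" and "\<And>q. q \<in> K \<Longrightarrow> m \<le> q"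
proof -
  have bdd: "bdd_below ((\<lambda>q. q x) ` K)" for x
  proof (rule bdd_belowI2[of K "- p (- x)"])
    fix q assume "q \<in> K"
    then show "- p (- x) \<le> q x"
      using sub[of q] sublinear_minus[of q x] le_funD[of q p "- x"] by simp
  qed
  have le: "m x \<le> q x" if "q \<in> K" for q x
    unfolding m_def using bdd that by (rule cINF_lower)
  then show "\<And>q. q \<in> K \<Longrightarrow> m \<le> q"
    by (simp add: le_fun_def)
  have ge: "c \<le> m x" if "\<And>q. q \<in> K \<Longrightarrow> c \<le> q x" for c x
    unfolding m_def using ne that by (rule cINF_greatest)
  show "sublinear m"
  proof (rule sublinearI)
    fix x y
    \<comment> \<open>The two infima on the right may be approached by different members of
      \<open>K\<close>; the smaller of two comparable members serves both.\<close>
    have *: "m (x + y) \<le> q x + r y" if qr: "q \<in> K" "r \<in> K" for q r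
    proof -
      obtain s where s: "s \<in> K" "s \<le> q" "s \<le> r"
        using chain[OF qr] qr by blast
      have "m (x + y) \<le> s x + s y"
        using le[OF s(1), of "x + y"] sub[OF s(1)] sublinear_add[of s x y] by linarith
      also have "\<dots> \<le> q x + r y"
        using s by (intro add_mono) (auto simp: le_fun_def)
      finally show ?thesis .
    qed
    have "m (x + y) - m y \<le> m x"
    proof (rule ge)
      fix q assume q: "q \<in> K"
      have "m (x + y) - q x \<le> m y"
        using *[OF q] by (intro ge) (simp add: algebra_simps)
      then show "m (x + y) - m y \<le> q x" by simp
    qed
    then show "m (x + y) \<le> m x + m y" by simp
  next
    fix c :: real and x assume c: "0 < c"
    have "m (c *\<^sub>R x) / c \<le> m x"
    proof (rule ge)
      fix q assume q: "q \<in> K"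
      have "m (c *\<^sub>R x) \<le> c * q x"
        using le[OF q, of "c *\<^sub>R x"] sub[OF q] sublinear_scaleR[OF _ c, of q x] by simp
      then show "m (c *\<^sub>R x) / c \<le> q x"
        using c by (simp add: field_simps)
    qed
    then show "m (c *\<^sub>R x) \<le> c * m x"
      using c by (simp add: field_simps)
  qed
qed

text \<open>If \<open>m\<close> is minimal, then it equals its reduction \<open>x \<mapsto> inf {m (x + t y) - t m y | t \<ge> 0}\<close>
  in every direction \<open>y\<close>; taking \<open>t = 1\<close> gives \<open>m x + m y \<le> m (x + y)\<close>.\<close>

lemma minimal_sublinear_imp_linear:
  assumes m: "sublinear m" and min: "\<And>q. sublinear q \<Longrightarrow> q \<le> m \<Longrightarrow> q = m"
  shows "linear m"
proof -
  have add: "m (x + y) = m x + m y" for x y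
  proof (rule antisym)
    show "m (x + y) \<le> m x + m y"
      using m by (rule sublinear_add)
    define q where "q x = (INF t\<in>{0..}. m (x + t *\<^sub>R y) - t * m y)" for x
    have bdd: "bdd_below ((\<lambda>t. m (x + t *\<^sub>R y) - t * m y) ` {0..})" for x
    proof (rule bdd_belowI2[of _ "- m (- x)"])
      fix t :: real assume "t \<in> {0..}"
      then have "t * m y = m (t *\<^sub>R y)"
        using sublinear_scaleR[OF m, of t y] sublinear_zero[OF m] by (cases "t = 0") auto
      also have "\<dots> \<le> m (x + t *\<^sub>R y) + m (- x)"
        using sublinear_add[OF m, of "x + t *\<^sub>R y" "- x"] by simp
      finally show "- m (- x) \<le> m (x + t *\<^sub>R y) - t * m y" by simp
    qed
    have le: "q x \<le> m (x + t *\<^sub>R y) - t * m y" if "0 \<le> t" for x t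
      unfolding q_def using bdd that by (intro cINF_lower) auto
    have ge: "c \<le> q x" if "\<And>t. 0 \<le> t \<Longrightarrow> c \<le> m (x + t *\<^sub>R y) - t * m y" for c x
      unfolding q_def using that by (intro cINF_greatest) auto
    have "sublinear q"
    proof (rule sublinearI)
      fix a b
      \<comment> \<open>The parameter \<open>s + t\<close> is admissible for \<open>a + b\<close>,
        and the subtracted multiples of \<open>m y\<close> then add up exactly.\<close>
      have *: "q (a + b) \<le> (m (a + s *\<^sub>R y) - s * m y) + (m (b + t *\<^sub>R y) - t * m y)"
        if "0 \<le> s" "0 \<le> t" for s t
        using le[of "s + t" "a + b"] that sublinear_add[OF m, of "a + s *\<^sub>R y" "b + t *\<^sub>R y"]
        by (simp add: algebra_simps)
      have "q (a + b) - q b \<le> q a"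
      proof (rule ge)
        fix s :: real assume s: "0 \<le> s"
        have "q (a + b) - (m (a + s *\<^sub>R y) - s * m y) \<le> q b"
          using *[OF s] by (intro ge) (simp add: algebra_simps)
        then show "q (a + b) - q b \<le> m (a + s *\<^sub>R y) - s * m y" by simp
      qed
      then show "q (a + b) \<le> q a + q b" by simp
    next
      fix c :: real and x assume c: "0 < c"
      have "q (c *\<^sub>R x) / c \<le> q x"
      proof (rule ge)
        fix t :: real assume t: "0 \<le> t"
        have "q (c *\<^sub>R x) \<le> m (c *\<^sub>R (x + t *\<^sub>R y)) - (c * t) * m y"
          using le[of "c * t" "c *\<^sub>R x"] c t by (simp add: scaleR_add_right)
        also have "\<dots> = c * (m (x + t *\<^sub>R y) - t * m y)"
          by (simp add: sublinear_scaleR[OF m c] right_diff_distrib)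
        finally show "q (c *\<^sub>R x) / c \<le> m (x + t *\<^sub>R y) - t * m y"
          using c by (simp add: field_simps)
      qed
      then show "q (c *\<^sub>R x) \<le> c * q x"
        using c by (simp add: field_simps)
    qed
    moreover have "q \<le> m"
      using le[of 0] by (simp add: le_fun_def)
    ultimately have "q = m" by (rule min)
    then show "m x + m y \<le> m (x + y)"
      using le[of 1 x] by simp
  qed
  have neg: "m (- x) = - m x" for x
    using add[of x "- x"] sublinear_zero[OF m] by simp
  have "m (c *\<^sub>R x) = c * m x" for c x
    using sublinear_scaleR[OF m, of c x] sublinear_scaleR[OF m, of "- c" x]
      neg[of "c *\<^sub>R x"] sublinear_zero[OF m]
    by (cases c "0::real" rule: linorder_cases) auto
  with add show ?thesis
    by (intro linearI) auto
qed

text \<open>Hahn-Banach: Zorn's lemma for the reversed order gives a minimal sublinear function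
  below \<open>p\<close>, and minimal ones are linear.\<close>

lemma linear_below_sublinear:
  assumes p: "sublinear p"
  obtains l where "linear l" and "l \<le> p"
proof -
  define A where "A = {q. sublinear q \<and> q \<le> p}"
  have "\<exists>m\<in>A. \<forall>a\<in>A. m \<ge> a \<longrightarrow> a = m"
  proof (rule predicate_Zorn)
    show "partial_order_on A (relation_of (\<ge>) A)"
      by (rule partial_order_on_relation_ofI) auto
    fix K assume "K \<in> Chains (relation_of (\<ge>) A)"
    then have K: "K \<subseteq> A" "\<And>q r. q \<in> K \<Longrightarrow> r \<in> K \<Longrightarrow> q \<le> r \<or> r \<le> q"
      by (auto simp: Chains_def relation_of_def)
    show "\<exists>u\<in>A. \<forall>a\<in>K. a \<ge> u"
    proof (cases "K = {}")
      case True
      then show ?thesis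
        using p by (auto simp: A_def)
    next
      case False
      then obtain q where "q \<in> K" by blast
      have "sublinear (\<lambda>x. INF q\<in>K. q x)" and le: "\<And>q. q \<in> K \<Longrightarrow> (\<lambda>x. INF q\<in>K. q x) \<le> q"
        using sublinear_Inf_chain[of K p] False K by (auto simp: A_def)
      moreover from le[OF \<open>q \<in> K\<close>] have "(\<lambda>x. INF q\<in>K. q x) \<le> p"
        using K(1) \<open>q \<in> K\<close> by (auto simp: A_def intro: order_trans)
      ultimately show ?thesis
        unfolding A_def by blast
    qed
  qed
  then obtain m where m: "sublinear m" "m \<le> p" and "\<And>q. sublinear q \<Longrightarrow> q \<le> p \<Longrightarrow> q \<le> m \<Longrightarrow> q = m"
    by (auto simp: A_def)
  then have "linear m"
    by (meson minimal_sublinear_imp_linear order_trans)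
  with m(2) show ?thesis
    using that by blast
qed

text \<open>The function \<open>p\<close> below is the one-sided directional derivative of
  \<open>f\<close> at \<open>x\<close>. Convexity makes it sublinear, the Lipschitz bound keeps it
  finite, and any linear functional below it is a subgradient.\<close>

lemma lipschitz_convex_subgradient:
  fixes f :: "'a::real_normed_vector \<Rightarrow> real"
  assumes cvx: "convex_on UNIV f" and lip: "\<And>x y. f y - f x \<le> norm (y - x)"
  obtains l where "bounded_linear l" and "\<And>y. l y \<le> f (x + y) - f x" and "\<And>y. \<bar>l y\<bar> \<le> norm y"
proof -
  define p where "p y = (INF t\<in>{0<..}. (f (x + t *\<^sub>R y) - f x) / t)" for y
  have bdd: "bdd_below ((\<lambda>t. (f (x + t *\<^sub>R y) - f x) / t) ` {0<..})" for y
  proof (rule bdd_belowI2[of _ "- norm y"])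
    fix t :: real assume "t \<in> {0<..}"
    then show "- norm y \<le> (f (x + t *\<^sub>R y) - f x) / t"
      using lip[of x "x + t *\<^sub>R y"] by (simp add: field_simps)
  qed
  have le: "p y \<le> (f (x + t *\<^sub>R y) - f x) / t" if "0 < t" for y t
    unfolding p_def using bdd that by (intro cINF_lower) auto
  have ge: "c \<le> p y" if "\<And>t. 0 < t \<Longrightarrow> c \<le> (f (x + t *\<^sub>R y) - f x) / t" for c y
    unfolding p_def using that by (intro cINF_greatest) auto
  have "sublinear p"
  proof (rule sublinearI)
    fix a b
    have *: "p (a + b) \<le> (f (x + s *\<^sub>R a) - f x) / s + (f (x + t *\<^sub>R b) - f x) / t"
      if st: "0 < s" "0 < t" for s t
    proof -
      \<comment> \<open>The weights \<open>u\<close>, \<open>v\<close> and the step \<open>r\<close>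
        are chosen so that the convex combination of \<open>x + s a\<close> and
        \<open>x + t b\<close> is \<open>x + r (a + b)\<close>; dividing by \<open>r\<close> then
        turns the weights into \<open>1 / s\<close> and \<open>1 / t\<close>.\<close>
      define r where "r = s * t / (s + t)"
      have r: "0 < r" using st by (simp add: r_def)
      define u where "u = t / (s + t)"
      define v where "v = s / (s + t)"
      have uv: "u + v = 1" "0 \<le> u" "0 \<le> v" "u * s = r" "v * t = r"
        using st by (auto simp: u_def v_def r_def simp flip: add_divide_distrib)
      have "u *\<^sub>R (x + s *\<^sub>R a) + v *\<^sub>R (x + t *\<^sub>R b) = (u + v) *\<^sub>R x + (u * s) *\<^sub>R a + (v * t) *\<^sub>R b"
        by (simp add: algebra_simps)
      also have "\<dots> = x + r *\<^sub>R (a + b)"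
        by (simp add: uv scaleR_add_right)
      finally have "f (x + r *\<^sub>R (a + b)) \<le> u * f (x + s *\<^sub>R a) + v * f (x + t *\<^sub>R b)"
        using cvx uv unfolding convex_on_def by (metis UNIV_I)
      also have "\<dots> - f x = u * (f (x + s *\<^sub>R a) - f x) + v * (f (x + t *\<^sub>R b) - f x)"
        using arg_cong[OF uv(1), of "\<lambda>c. c * f x"] by (simp add: algebra_simps)
      finally have "f (x + r *\<^sub>R (a + b)) - f x
          \<le> u * (f (x + s *\<^sub>R a) - f x) + v * (f (x + t *\<^sub>R b) - f x)" by simp
      then have "(f (x + r *\<^sub>R (a + b)) - f x) / r
          \<le> (u * (f (x + s *\<^sub>R a) - f x) + v * (f (x + t *\<^sub>R b) - f x)) / r"
        using r by (simp add: divide_right_mono)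
      also have "\<dots> = u / r * (f (x + s *\<^sub>R a) - f x) + v / r * (f (x + t *\<^sub>R b) - f x)"
        by (simp add: add_divide_distrib)
      also have "\<dots> = (f (x + s *\<^sub>R a) - f x) / s + (f (x + t *\<^sub>R b) - f x) / t"
      proof -
        have "u / r = 1 / s" "v / r = 1 / t"
          using st by (simp_all add: u_def v_def r_def)
        then show ?thesis by simp
      qed
      finally show ?thesis
        using le[OF r, of "a + b"] by simp
    qed
    have "p (a + b) - p b \<le> p a"
    proof (rule ge)
      fix s :: real assume s: "0 < s"
      have "p (a + b) - (f (x + s *\<^sub>R a) - f x) / s \<le> p b"
        using *[OF s] by (intro ge) (simp add: algebra_simps)
      then show "p (a + b) - p b \<le> (f (x + s *\<^sub>R a) - f x) / s" by simp
    qed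
    then show "p (a + b) \<le> p a + p b" by simp
  next
    fix c :: real and y assume c: "0 < c"
    have "p (c *\<^sub>R y) / c \<le> p y"
    proof (rule ge)
      fix t :: real assume t: "0 < t"
      then show "p (c *\<^sub>R y) / c \<le> (f (x + t *\<^sub>R y) - f x) / t"
        using le[of "t / c" "c *\<^sub>R y"] c by (simp add: field_simps)
    qed
    then show "p (c *\<^sub>R y) \<le> c * p y"
      using c by (simp add: field_simps)
  qed
  then obtain l where l: "linear l" "l \<le> p"
    by (rule linear_below_sublinear)
  have sub: "l y \<le> f (x + y) - f x" for y
    using l(2) le[of 1 y] by (auto simp: le_fun_def intro: order_trans)
  have "l y \<le> norm y" for y
    using sub[of y] lip[of "x + y" x] by simp
  from this[of y for y] this[of "- y" for y] have abs: "\<bar>l y\<bar> \<le> norm y" for y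
    by (simp add: abs_le_iff linear_neg[OF l(1)])
  have "bounded_linear l"
    using l(1) abs by (intro bounded_linear_intro[where K = 1]) (auto simp: linear_add linear_scale)
  then show ?thesis
    using that sub abs by blast
qed

lemma convex_on_norm_diff: "convex_on UNIV (\<lambda>x::'a::real_normed_vector. norm (x - z))"
  using convex_on_dist[of UNIV z] by (simp add: dist_norm norm_minus_commute)

text \<open>A subgradient of the norm at \<open>z\<close> works: testing it in the direction
  \<open>- z\<close> forces \<open>l z\<close> up to \<open>norm z\<close>.\<close>

lemma norming_functional:
  fixes z :: "'a::real_normed_vector"
  obtains l where "bounded_linear l" and "l z = norm z" and "\<And>y. \<bar>l y\<bar> \<le> norm y"
proof -
  have "convex_on UNIV (norm :: 'a \<Rightarrow> real)"
    using convex_on_norm_diff[of 0] by simp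
  then obtain l where l: "bounded_linear l" "\<And>y. l y \<le> norm (z + y) - norm z"
      "\<And>y. \<bar>l y\<bar> \<le> norm y"
    using lipschitz_convex_subgradient[OF _ norm_triangle_ineq2, of z] by blast
  have "l z \<ge> norm z"
    using l(2)[of "- z"] by (simp add: linear_neg bounded_linear.linear[OF l(1)])
  moreover have "l z \<le> norm z"
    using l(3)[of z] by simp
  ultimately show ?thesis
    using l that by force
qed

section \<open>Weakly compact sets\<close>

lemma continuous_map_weak_topology:
  assumes "bounded_linear f"
  shows "continuous_map weak_topology euclideanreal f"
proof -
  have "openin weak_topology (f -` U)" if "open U" for U
    unfolding weak_topology_def using assms that by (intro topology_generated_by_Basis) blast
  then show ?thesis
    by (simp add: continuous_map_def vimage_def)
qed

lemma closedin_weak_topology_le: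
  fixes f :: "'a::real_normed_vector \<Rightarrow> real"
  assumes "bounded_linear f"
  shows "closedin weak_topology {z. f z \<le> c}"
proof -
  have "closedin euclideanreal {..c}"
    using closed_atMost by (rule closed_closedin[THEN iffD1])
  from closedin_continuous_map_preimage[OF continuous_map_weak_topology[OF assms] this]
  show ?thesis by simp
qed

text \<open>Weak lower semicontinuity of the norm: by norming functionals the norm is a supremum
  over the dual unit ball \<open>N\<close>, so the set is an intersection of weakly closed
  half-spaces.\<close>

lemma closedin_weak_topology_norm_le:
  fixes l :: "'a::real_normed_vector \<Rightarrow> real"
  assumes l: "bounded_linear l"
  shows "closedin weak_topology {z. norm z \<le> l z + c}"
proof -
  define N where "N = {k :: 'a \<Rightarrow> real. bounded_linear k \<and> (\<forall>y. \<bar>k y\<bar> \<le> norm y)}"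
  have *: "norm z \<le> l z + c \<longleftrightarrow> (\<forall>k\<in>N. k z - l z \<le> c)" for z
  proof
    assume L: "norm z \<le> l z + c"
    show "\<forall>k\<in>N. k z - l z \<le> c"
    proof
      fix k assume "k \<in> N"
      then have "\<bar>k z\<bar> \<le> norm z"
        by (simp add: N_def)
      with L show "k z - l z \<le> c" by linarith
    qed
  next
    assume R: "\<forall>k\<in>N. k z - l z \<le> c"
    obtain k where "bounded_linear k" and kz: "k z = norm z" and "\<And>y. \<bar>k y\<bar> \<le> norm y"
      using norming_functional[of z] by blast
    then have "k \<in> N"
      by (simp add: N_def)
    with bspec[OF R this] kz show "norm z \<le> l z + c" by simp
  qed
  have "{z. norm z \<le> l z + c} = (\<Inter>k\<in>N. {z. k z - l z \<le> c})"
  proof (rule set_eqI)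
    show "z \<in> {z. norm z \<le> l z + c} \<longleftrightarrow> z \<in> (\<Inter>k\<in>N. {z. k z - l z \<le> c})" for z
      unfolding INT_iff mem_Collect_eq by (rule *)
  qed
  moreover have "(\<lambda>_. 0) \<in> N"
    unfolding N_def mem_Collect_eq using bounded_linear_zero by simp
  then have "N \<noteq> {}" by blast
  moreover have "closedin weak_topology {z. k z - l z \<le> c}" if "k \<in> N" for k
    using that l by (intro closedin_weak_topology_le bounded_linear_sub) (auto simp: N_def)
  ultimately show ?thesis
    by (simp add: closedin_INT)
qed

text \<open>The sets of approximate solutions in \<open>C\<close> are weakly closed and shrink with
  \<open>e\<close>, so the finite intersection property gives an exact solution.\<close>

lemma weakly_compact_norm_le_attained:
  fixes C :: "'a::real_normed_vector set"
  assumes C: "compactin weak_topology C" and l: "bounded_linear l"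
    and approx: "\<And>e. 0 < e \<Longrightarrow> \<exists>z\<in>C. norm z \<le> l z + c + e"
  obtains z where "z \<in> C" and "norm z \<le> l z + c"
proof -
  define S where "S e = {z. norm z \<le> l z + (c + e)}" for e
  have "C \<inter> \<Inter>(S ` {0<..}) \<noteq> {}"
  proof -
    have "C \<inter> \<Inter>F \<noteq> {}" if F: "finite F" "F \<subseteq> S ` {0<..}" for F
    proof -
      obtain E where E: "E \<subseteq> {0<..}" "finite E" "F = S ` E"
        using finite_subset_image[OF F] by blast
      \<comment> \<open>Inserting 1 keeps the minimum meaningful when \<open>E\<close> is
        empty.\<close>
      define e where "e = Min (insert 1 E)"
      have "0 < e"
        using E by (auto simp: e_def)
      then obtain z where z: "z \<in> C" "norm z \<le> l z + c + e"
        using approx by blast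
      have "e \<le> d" if "d \<in> E" for d
        using E that by (simp add: e_def)
      with z(2) have "z \<in> \<Inter>F"
        unfolding E(3) S_def by force
      with z(1) show ?thesis by blast
    qed
    moreover have "\<forall>D\<in>S ` {0<..}. closedin weak_topology D"
      unfolding S_def using closedin_weak_topology_norm_le[OF l] by blast
    ultimately show ?thesis
      using C unfolding compactin_fip by blast
  qed
  then obtain z where z: "z \<in> C" "\<And>e. 0 < e \<Longrightarrow> norm z \<le> l z + (c + e)"
    by (auto simp: S_def)
  have "norm z \<le> l z + c"
  proof (rule field_le_epsilon)
    fix e :: real assume "0 < e"
    from z(2)[OF this] show "norm z \<le> l z + c + e" by linarith
  qed
  with z(1) show ?thesis using that by blast
qed

text \<open>Uniform boundedness: the functionals bounded by \<open>k\<close> on \<open>C\<close> form closed sets covering the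
  dual space, so by Baire one of them contains a ball.\<close>

lemma weakly_compact_imp_bounded:
  fixes C :: "'a::real_normed_vector set"
  assumes C: "compactin weak_topology C"
  shows "bounded C"
proof -
  define D :: "nat \<Rightarrow> ('a \<Rightarrow>\<^sub>L real) set"
    where "D k = (\<Inter>z\<in>C. {l. \<bar>blinfun_apply l z\<bar> \<le> real k})" for k
  have closed: "closed (D k)" for k
    unfolding D_def by (intro closed_INT ballI closed_Collect_le continuous_intros)
  have "\<Union>(range D) = UNIV"
  proof -
    have "l \<in> \<Union>(range D)" for l
    proof -
      have "compactin euclideanreal (blinfun_apply l ` C)"
        using C continuous_map_weak_topology[OF blinfun.bounded_linear_right] by (rule image_compactin)
      then obtain B where B: "\<And>z. z \<in> C \<Longrightarrow> \<bar>blinfun_apply l z\<bar> \<le> B"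
        by (force dest: compact_imp_bounded simp: bounded_iff)
      obtain k where "B \<le> real k"
        using real_arch_simple by blast
      with B have "l \<in> D k"
        by (force simp: D_def)
      then show ?thesis by blast
    qed
    then show ?thesis by blast
  qed
  then have "euclidean interior_of \<Union>(range D) \<noteq> {}"
    by simp
  \<comment> \<open>Baire applies on the dual space, which is complete because the scalars
    are.\<close>
  then have "\<exists>k. interior (D k) \<noteq> {}"
    using Baire_category_alt[of euclidean "range D"] closed
    by (auto simp: completely_metrizable_space_euclidean)
  then obtain k l0 where "l0 \<in> interior (D k)"
    by blast
  then obtain r where r: "0 < r" "cball l0 r \<subseteq> D k"
    unfolding mem_interior_cball by blast
  have "norm z \<le> 2 * real k / r" if z: "z \<in> C" for z
  proof -
    obtain g where g: "bounded_linear g" "g z = norm z" "\<And>y. \<bar>g y\<bar> \<le> norm y"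
      using norming_functional[of z] by blast
    define h where "h = Blinfun g"
    have h: "blinfun_apply h = g"
      using g(1) by (simp add: h_def bounded_linear_Blinfun_apply)
    have "norm h \<le> 1"
      using g(3) by (intro norm_blinfun_bound) (auto simp: h)
    \<comment> \<open>Both the centre and a point of the ball are bounded by \<open>k\<close> at
      \<open>z\<close>; their difference is \<open>r * norm z\<close>, whence the bound
      \<open>2 * k / r\<close>.\<close>
    then have "l0 + r *\<^sub>R h \<in> D k" "l0 \<in> D k"
      using r by (auto simp: dist_norm intro!: subsetD[OF r(2)])
    then have "\<bar>blinfun_apply l0 z + r * norm z\<bar> \<le> real k" "\<bar>blinfun_apply l0 z\<bar> \<le> real k"
      using z g(2) by (auto simp: D_def blinfun.add_left blinfun.scaleR_left h)
    then have "r * norm z \<le> 2 * real k" by linarith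
    then show ?thesis
      using r(1) by (simp add: field_simps)
  qed
  then show ?thesis
    by (auto simp: bounded_iff)
qed

section \<open>The supremum function\<close>

text \<open>This is the function \<open>f\<close> of the introduction. For nonempty \<open>C\<close>
  the real supremum is genuine, since the triangle inequality bounds the excess by
  \<open>norm x\<close>.\<close>

definition sup_excess :: "'a::real_normed_vector set \<Rightarrow> 'a \<Rightarrow> real" where
  "sup_excess C x = (SUP z\<in>C. norm (x - z) - norm z)"

lemma sup_excess_upper:
  assumes "z \<in> C"
  shows "norm (x - z) - norm z \<le> sup_excess C x"
proof -
  have "norm (x - z) - norm z \<le> norm x" for z
    using norm_triangle_ineq4[of x z] by simp
  then have "bdd_above ((\<lambda>z. norm (x - z) - norm z) ` C)"
    by (intro bdd_aboveI2)
  then show ?thesis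
    unfolding sup_excess_def using assms by (rule cSUP_upper2) simp
qed

lemma sup_excess_least:
  assumes "C \<noteq> {}" and "\<And>z. z \<in> C \<Longrightarrow> norm (x - z) - norm z \<le> c"
  shows "sup_excess C x \<le> c"
  unfolding sup_excess_def using assms by (rule cSUP_least)

lemma sup_excess_lipschitz:
  assumes "C \<noteq> {}"
  shows "sup_excess C y - sup_excess C x \<le> norm (y - x)"
proof -
  have "sup_excess C y \<le> sup_excess C x + norm (y - x)"
  proof (rule sup_excess_least[OF assms])
    fix z assume "z \<in> C"
    then show "norm (y - z) - norm z \<le> sup_excess C x + norm (y - x)"
      using sup_excess_upper[of z C x] norm_triangle_ineq[of "x - z" "y - x"] by simp
  qed
  then show ?thesis by simp
qed

lemma continuous_on_sup_excess:
  assumes "C \<noteq> {}"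
  shows "continuous_on S (sup_excess C)"
proof -
  have "1-lipschitz_on S (sup_excess C)"
  proof (rule lipschitz_onI)
    fix x y
    show "dist (sup_excess C x) (sup_excess C y) \<le> 1 * dist x y"
      using sup_excess_lipschitz[OF assms, of x y] sup_excess_lipschitz[OF assms, of y x]
      by (simp add: dist_norm norm_minus_commute abs_le_iff)
  qed simp
  then show ?thesis by (rule lipschitz_on_continuous_on)
qed

lemma convex_on_sup_excess:
  assumes "C \<noteq> {}"
  shows "convex_on UNIV (sup_excess C)"
  unfolding convex_on_def
proof (intro conjI ballI allI impI convex_UNIV)
  fix x y :: 'a and u v :: real
  assume uv: "0 \<le> u" "0 \<le> v" "u + v = 1"
  show "sup_excess C (u *\<^sub>R x + v *\<^sub>R y) \<le> u * sup_excess C x + v * sup_excess C y"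
  proof (rule sup_excess_least[OF assms])
    fix z assume z: "z \<in> C"
    have "norm (u *\<^sub>R x + v *\<^sub>R y - z) \<le> u * norm (x - z) + v * norm (y - z)"
      using convex_on_norm_diff[of z] uv by (simp add: convex_on_def)
    moreover have "norm z = u * norm z + v * norm z"
      using uv(3) by (metis distrib_right mult_1)
    ultimately have "norm (u *\<^sub>R x + v *\<^sub>R y - z) - norm z
        \<le> u * (norm (x - z) - norm z) + v * (norm (y - z) - norm z)"
      by (simp add: right_diff_distrib)
    also have "\<dots> \<le> u * sup_excess C x + v * sup_excess C y"
      using z uv by (intro add_mono mult_left_mono sup_excess_upper)
    finally show "norm (u *\<^sub>R x + v *\<^sub>R y - z) - norm z \<le> u * sup_excess C x + v * sup_excess C y" .
  qed
qed

text \<open>Membership says that, on some step from \<open>x\<close> towards some \<open>z \<in> C\<close>, the convex function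
  \<open>sup_excess C\<close> falls at an average rate above \<open>sup_excess C x + norm z - e\<close>. Every
  subgradient \<open>l\<close> at \<open>x\<close> then satisfies \<open>l (x - z) - norm z > sup_excess C x - e\<close>.\<close>

definition steep_points :: "'a::real_normed_vector set \<Rightarrow> real \<Rightarrow> 'a set" where
  "steep_points C e =
     (\<Union>z\<in>C. \<Union>t\<in>{0<..}. {x. sup_excess C (x - t *\<^sub>R (x - z))
        < sup_excess C x - t * (sup_excess C x + norm z - e)})"

lemma open_steep_points:
  assumes "C \<noteq> {}"
  shows "open (steep_points C e)"
proof -
  have "continuous_on UNIV (\<lambda>x. sup_excess C (x - t *\<^sub>R (x - z)))" for t z
    by (rule continuous_on_compose2[OF continuous_on_sup_excess[OF assms]])
      (auto intro!: continuous_intros)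
  then show ?thesis
    unfolding steep_points_def
    by (intro open_UN ballI open_Collect_less continuous_on_diff continuous_on_mult
        continuous_on_add continuous_on_const continuous_on_sup_excess[OF assms])
qed

text \<open>Moving from \<open>x0\<close> directly away from an almost maximal \<open>z\<close>
  stretches \<open>norm (x0 - z)\<close> by \<open>1 + r\<close>, which makes
  \<open>sup_excess C\<close> grow almost as fast as possible. The step back from the new point to
  \<open>x0\<close> is therefore steep.\<close>

lemma dense_steep_points:
  assumes ne: "C \<noteq> {}" and "bounded C" and e: "0 < e"
  shows "closure (steep_points C e) = UNIV"
proof -
  have "\<exists>x\<in>steep_points C e. dist x x0 < d" if d: "0 < d" for x0 d
  proof -
    obtain B where B: "0 < B" "\<And>z. z \<in> C \<Longrightarrow> norm z \<le> B"
      using \<open>bounded C\<close> by (auto simp: bounded_pos)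
    define M where "M = norm x0 + B"
    have M: "0 < M" "norm (x0 - z) \<le> M" if "z \<in> C" for z
      using B(1) B(2)[OF that] norm_triangle_ineq4[of x0 z] norm_ge_zero[of x0]
      unfolding M_def by linarith+
    with ne have "0 < M" by blast
    \<comment> \<open>With \<open>M\<close> bounding all distances from \<open>x0\<close> to
      \<open>C\<close>, this moves \<open>x0\<close> by at most \<open>d / 2\<close>.\<close>
    define r where "r = d / (2 * M)"
    have r: "0 < r"
      using d \<open>0 < M\<close> by (simp add: r_def)
    \<comment> \<open>The error in the choice of \<open>z\<close> gets multiplied by
      \<open>1 + r\<close> and must then equal the allowed loss \<open>r * e\<close>.\<close>
    define \<epsilon> where "\<epsilon> = r * e / (1 + r)"
    have \<epsilon>: "0 < \<epsilon>" "(1 + r) * \<epsilon> = r * e"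
      using r e by (auto simp: \<epsilon>_def)
    have "\<exists>z\<in>C. sup_excess C x0 - \<epsilon> < norm (x0 - z) - norm z"
    proof (rule ccontr)
      assume "\<not> ?thesis"
      then have "sup_excess C x0 \<le> sup_excess C x0 - \<epsilon>"
        by (intro sup_excess_least[OF ne]) (auto simp: not_less)
      with \<epsilon>(1) show False by simp
    qed
    then obtain z where z: "z \<in> C" "sup_excess C x0 - \<epsilon> < norm (x0 - z) - norm z"
      by blast
    define x where "x = x0 + r *\<^sub>R (x0 - z)"
    \<comment> \<open>The fraction of the way from \<open>x\<close> to \<open>z\<close> at which
      \<open>x0\<close> lies.\<close>
    define t where "t = r / (1 + r)"
    have t: "0 < t" "(1 + r) * t = r"
      using r by (auto simp: t_def)
    have xz: "x - z = (1 + r) *\<^sub>R (x0 - z)"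
      by (simp add: x_def algebra_simps)
    have x0: "x - t *\<^sub>R (x - z) = x0"
      using t(2) by (simp add: xz mult.commute) (simp add: x_def)
    have "(1 + r) * norm (x0 - z) - norm z \<le> sup_excess C x"
      using sup_excess_upper[OF z(1), of x] r by (simp add: xz)
    moreover have "(1 + r) * (sup_excess C x0 - \<epsilon>) < (1 + r) * (norm (x0 - z) - norm z)"
      using z(2) r by simp
    ultimately have "(1 + r) * sup_excess C x0 + r * norm z - r * e < sup_excess C x"
      using \<epsilon>(2) by (simp add: algebra_simps)
    \<comment> \<open>Written with a common factor \<open>1 + r\<close>, so that it can be cancelled
      at the end.\<close>
    also have "sup_excess C x = (1 + r) * sup_excess C x - ((1 + r) * t) * sup_excess C x"
      unfolding t(2) by (simp add: algebra_simps)
    finally have "(1 + r) * sup_excess C x0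
        < (1 + r) * sup_excess C x - ((1 + r) * t) * (sup_excess C x + norm z - e)"
      unfolding t(2) by (simp add: algebra_simps)
    also have "\<dots> = (1 + r) * (sup_excess C x - t * (sup_excess C x + norm z - e))"
      by (simp add: algebra_simps)
    finally have "sup_excess C x0 < sup_excess C x - t * (sup_excess C x + norm z - e)"
      using r by (simp add: mult_less_cancel_left_pos)
    then have "x \<in> steep_points C e"
      unfolding steep_points_def using z(1) t(1) x0 by auto
    moreover have "dist x x0 < d"
    proof -
      have "dist x x0 = r * norm (x0 - z)"
        using r by (simp add: x_def dist_norm)
      also have "\<dots> \<le> r * M"
        using M(2)[OF z(1)] r by (intro mult_left_mono) auto
      also have "\<dots> < d"
        using d \<open>0 < M\<close> by (simp add: r_def)
      finally show ?thesis .
    qed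
    ultimately show ?thesis by blast
  qed
  then show ?thesis
    by (auto simp: closure_approachable)
qed

lemma steep_points_imp_attains_sup:
  assumes ne: "C \<noteq> {}" and C: "compactin weak_topology C"
    and x: "\<And>e. 0 < e \<Longrightarrow> x \<in> steep_points C e"
  shows "attains_sup_on (\<lambda>z. norm (x - z) - norm z) C"
proof -
  let ?f = "sup_excess C"
  obtain l where l: "bounded_linear l" "\<And>y. l y \<le> ?f (x + y) - ?f x" "\<And>y. \<bar>l y\<bar> \<le> norm y"
    using lipschitz_convex_subgradient[OF convex_on_sup_excess[OF ne] sup_excess_lipschitz[OF ne], of x]
    by blast
  note lin = bounded_linear.linear[OF l(1)]
  \<comment> \<open>The subgradient inequality along the steep step, arranged for the functional
    \<open>- l\<close> and the constant \<open>l x - sup_excess C x\<close>.\<close>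
  have "\<exists>z\<in>C. norm z \<le> - l z + (l x - ?f x) + e" if e: "0 < e" for e
  proof -
    obtain z t where z: "z \<in> C" "0 < t"
        "?f (x - t *\<^sub>R (x - z)) < ?f x - t * (?f x + norm z - e)"
      using x[OF e] by (auto simp: steep_points_def)
    have "- (t * l (x - z)) \<le> ?f (x - t *\<^sub>R (x - z)) - ?f x"
      using l(2)[of "- (t *\<^sub>R (x - z))"] by (simp add: linear_neg[OF lin] linear_scale[OF lin])
    with z(3) have "t * (?f x + norm z - e) < t * l (x - z)"
      by linarith
    then have "?f x + norm z - e < l (x - z)"
      using z(2) by simp
    with z(1) show ?thesis
      by (intro bexI[of _ z]) (auto simp: linear_diff[OF lin])
  qed
  then obtain z where z: "z \<in> C" "norm z \<le> - l z + (l x - ?f x)"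
    by (rule weakly_compact_norm_le_attained[OF C bounded_linear_minus[OF l(1)]])
  have "?f x \<le> norm (x - z) - norm z"
    using z(2) l(3)[of "x - z"] by (simp add: linear_diff[OF lin] abs_le_iff)
  then have max: "norm (x - y) - norm y \<le> norm (x - z) - norm z" if "y \<in> C" for y
    using sup_excess_upper[OF that, of x] by simp
  have "ereal (norm (x - z) - norm z) = (SUP y\<in>C. ereal (norm (x - y) - norm y))"
    using z(1) max by (intro antisym SUP_upper SUP_least) auto
  with z(1) show ?thesis
    unfolding attains_sup_on_def by blast
qed

theorem corollary2p1:
  fixes C :: "'a::banach set"
  assumes "C \<noteq> {}"
    and "compactin weak_topology C"
  shows "closure {x :: 'a. attains_sup_on (\<lambda>z. norm (x - z) - norm z) C} = UNIV"
proof -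
  \<comment> \<open>Countably many tolerances tending to 0, as Baire's theorem requires.\<close>
  define G where "G n = steep_points C (1 / real (Suc n))" for n
  have "open (G n)" "closure (G n) = UNIV" for n
    unfolding G_def
    using open_steep_points[OF assms(1)]
      dense_steep_points[OF assms(1) weakly_compact_imp_bounded[OF assms(2)]]
    by simp_all
  then have dense: "closure (\<Inter>(range G)) = UNIV"
    using Baire_category[of euclidean "range G"]
    by (auto simp: completely_metrizable_space_euclidean)
  \<comment> \<open>A larger tolerance weakens the condition, so the sequence of tolerances in
    \<open>G\<close> handles every positive \<open>e\<close>.\<close>
  have mono: "steep_points C d \<subseteq> steep_points C e" if "d \<le> e" for d e
  proof -
    have "s - t * (s + norm z - d) \<le> s - t * (s + norm z - e)" if "0 < t" for s t z
      using that \<open>d \<le> e\<close> by simp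
    then show ?thesis
      unfolding steep_points_def by (fastforce intro: less_le_trans)
  qed
  have "attains_sup_on (\<lambda>z. norm (x - z) - norm z) C" if x: "x \<in> \<Inter>(range G)" for x
  proof (rule steep_points_imp_attains_sup[OF assms])
    fix e :: real assume "0 < e"
    then obtain n where "1 / real (Suc n) < e"
      using nat_approx_posE by blast
    then show "x \<in> steep_points C e"
      using x mono[of "1 / real (Suc n)" e] by (auto simp: G_def)
  qed
  then have "\<Inter>(range G) \<subseteq> {x. attains_sup_on (\<lambda>z. norm (x - z) - norm z) C}"
    by blast
  then show ?thesis
    using dense closure_mono by blast
qed

end
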